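(* Let $G$ be a compact Hausdorff group and let $S\subset G$ be a nonempty finite symmetric set with $e\notin S$. The Laplacian $\mathcal{L}$ preserves each $\mathcal{A}_\sigma$, $\sigma\in\widehat{G}$, and acts there as $I_{d_\sigma}\otimes(I_{d_\sigma}-M_\sigma)$, where $M_\sigma=\frac{1}{|S|}\sum_{s\in S}\sigma(s)$. Consequently, $\omega(\sigma)=1-\operatorname{Tr}[M_\sigma]/d_\sigma$ is defined for every $\sigma\in\widehat{G}$ and satisfies $\omega(\sigma)\in[0,2]$.
   Context: $e$ is the identity of $G$; symmetric means $s^{-1}\in S$ for all $s\in S$. $L^2(G)$ is taken with respect to normalized Haar measure $dg$, with inner product $\langle f,h\rangle=\int_G\overline{f(g)}h(g)\,dg$. The averaging operator on $L^2(G)$ is $(Af)(g)=\frac{1}{|S|}\sum_{s\in S}f(gs)$ and the Laplacian is $\mathcal{L}=I-A$. $\widehat{G}$ is the set of equivalence classes of irreducible (continuous, finite-dimensional) unitary representations of $G$, each represented by a unitary matrix representation $\sigma:G\to U(d_\sigma)$ with matrix entries $\sigma_{ij}$, and $\mathcal{A}_\sigma=\operatorname{span}\{\sigma_{ij}\}\subseteq L^2(G)$ is its Peter-Weyl block. "Acts on $\mathcal{A}_\sigma$ as $I_{d_\sigma}\otimes B$" refers to the identification $\sigma_{ij}\leftrightarrow e_i\otimes e_j$, i.e. $\sigma_{ij}\mapsto\sum_k\sigma_{ik}B_{kj}$. *)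

theory Defs
  imports
    "HOL-Probability.Probability"
    "HOL-Algebra.Coset"
    "Jordan_Normal_Form.Schur_Decomposition"
    "Jordan_Normal_Form.VS_Connect"
begin

locale compact_hausdorff_group = group G for G (structure) +
  fixes X :: "'a topology"
  assumes topspace_eq: "topspace X = carrier G"
    and mult_continuous: "continuous_map (prod_topology X X) X (\<lambda>(x, y). x \<otimes> y)"
    and inv_continuous: "continuous_map X X (\<lambda>x. inv x)"
    and compact: "compact_space X"
    and hausdorff: "Hausdorff_space X"

text \<open>
  The normalized Haar measure of a compact group is its unique regular Borel probability
  measure invariant under left and right translations.  (Each one-sided invariance implies
  the other one, because compact groups are unimodular.)
\<close>

definition normalized_haar_measure ::
    "('a, 'b) monoid_scheme \<Rightarrow> 'a topology \<Rightarrow> 'a measure \<Rightarrow> bool" where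
  "normalized_haar_measure G X \<mu> \<longleftrightarrow>
     sets \<mu> = sets (sigma (topspace X) {U. openin X U}) \<and>
     emeasure \<mu> (space \<mu>) = 1 \<and>
     (\<forall>A\<in>sets \<mu>. emeasure \<mu> A = (INF U\<in>{U. openin X U \<and> A \<subseteq> U}. emeasure \<mu> U)) \<and>
     (\<forall>A\<in>sets \<mu>. emeasure \<mu> A = (SUP K\<in>{K. compactin X K \<and> K \<subseteq> A}. emeasure \<mu> K)) \<and>
     (\<forall>a\<in>carrier G. \<forall>A\<in>sets \<mu>. emeasure \<mu> (a <#\<^bsub>G\<^esub> A) = emeasure \<mu> A) \<and>
     (\<forall>a\<in>carrier G. \<forall>A\<in>sets \<mu>. emeasure \<mu> (A #>\<^bsub>G\<^esub> a) = emeasure \<mu> A)"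

definition sq_integrable :: "'a measure \<Rightarrow> ('a \<Rightarrow> complex) set" where
  "sq_integrable \<mu> = {f \<in> borel_measurable \<mu>. integrable \<mu> (\<lambda>x. (cmod (f x))\<^sup>2)}"

definition ae_rel :: "'a measure \<Rightarrow> (('a \<Rightarrow> complex) \<times> ('a \<Rightarrow> complex)) set" where
  "ae_rel \<mu> = {(f, h). f \<in> sq_integrable \<mu> \<and> h \<in> sq_integrable \<mu> \<and> (AE x in \<mu>. f x = h x)}"

definition L2 :: "'a measure \<Rightarrow> ('a \<Rightarrow> complex) set set" where
  "L2 \<mu> = sq_integrable \<mu> // ae_rel \<mu>"

definition L2_class :: "'a measure \<Rightarrow> ('a \<Rightarrow> complex) \<Rightarrow> ('a \<Rightarrow> complex) set" where
  "L2_class \<mu> f = ae_rel \<mu> `` {f}"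

text \<open>
  Operations on \<open>L2 \<mu>\<close> are induced from operations on functions: the unions below run over
  all representatives, and each is a single class since the operations respect equality
  almost everywhere (see \<open>averaging_L2_class\<close> and \<open>laplacian_L2_class\<close>).
\<close>

definition L2_diff ::
    "'a measure \<Rightarrow> ('a \<Rightarrow> complex) set \<Rightarrow> ('a \<Rightarrow> complex) set \<Rightarrow> ('a \<Rightarrow> complex) set" where
  "L2_diff \<mu> p q = (\<Union>f\<in>p. \<Union>h\<in>q. L2_class \<mu> (\<lambda>x. f x - h x))"

definition right_average ::
    "('a, 'b) monoid_scheme \<Rightarrow> 'a set \<Rightarrow> ('a \<Rightarrow> complex) \<Rightarrow> 'a \<Rightarrow> complex" where
  "right_average G S f = (\<lambda>g. (1 / of_nat (card S)) * (\<Sum>s\<in>S. f (g \<otimes>\<^bsub>G\<^esub> s)))"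

definition averaging ::
    "('a, 'b) monoid_scheme \<Rightarrow> 'a measure \<Rightarrow> 'a set \<Rightarrow> ('a \<Rightarrow> complex) set \<Rightarrow> ('a \<Rightarrow> complex) set"
  where
  "averaging G \<mu> S p = (\<Union>f\<in>p. L2_class \<mu> (right_average G S f))"

definition laplacian ::
    "('a, 'b) monoid_scheme \<Rightarrow> 'a measure \<Rightarrow> 'a set \<Rightarrow> ('a \<Rightarrow> complex) set \<Rightarrow> ('a \<Rightarrow> complex) set"
  where
  "laplacian G \<mu> S p = L2_diff \<mu> p (averaging G \<mu> S p)"

locale haar_compact_group = compact_hausdorff_group +
  fixes \<mu>
  assumes haar: "normalized_haar_measure G X \<mu>"
begin

lemma sets_haar: "sets \<mu> = sets (sigma (topspace X) {U. openin X U})"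
  using haar by (simp add: normalized_haar_measure_def)

lemma space_haar: "space \<mu> = carrier G"
proof -
  have "space (sigma (topspace X) {U. openin X U}) = topspace X"
    by (rule space_measure_of) (auto dest: openin_subset)
  then show ?thesis
    using sets_eq_imp_space_eq[OF sets_haar] by (simp add: topspace_eq)
qed

lemma haar_right_invariant:
  "a \<in> carrier G \<Longrightarrow> A \<in> sets \<mu> \<Longrightarrow> emeasure \<mu> (A #> a) = emeasure \<mu> A"
  using haar by (simp add: normalized_haar_measure_def)

sublocale prob_space \<mu>
  using haar by (intro prob_spaceI) (simp add: normalized_haar_measure_def)

lemma right_translation_continuous:
  assumes "s \<in> carrier G"
  shows "continuous_map X X (\<lambda>x. x \<otimes> s)"
proof -
  have "continuous_map X (prod_topology X X) (\<lambda>x. (x, s))"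
    using assms by (intro continuous_map_pairedI) (auto simp: topspace_eq)
  from continuous_map_compose[OF this mult_continuous] show ?thesis
    by (simp add: o_def)
qed

lemma open_in_sets_haar: "openin X U \<Longrightarrow> U \<in> sets \<mu>"
  unfolding sets_haar by (subst sets_measure_of) (auto dest: openin_subset)

lemma continuous_measurable:
  fixes f :: "'a \<Rightarrow> complex"
  assumes "continuous_map X euclidean f"
  shows "f \<in> borel_measurable \<mu>"
proof (rule borel_measurableI)
  fix U :: "complex set" assume "open U"
  then have "openin X {x \<in> topspace X. f x \<in> U}"
    using assms by (intro openin_continuous_map_preimage[where Y = euclidean]) auto
  moreover have "{x \<in> topspace X. f x \<in> U} = f -` U \<inter> space \<mu>"
    by (auto simp: space_haar topspace_eq)
  ultimately show "f -` U \<inter> space \<mu> \<in> sets \<mu>"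
    by (metis open_in_sets_haar)
qed

lemma continuous_sq_integrable:
  assumes f: "continuous_map X euclidean f"
  shows "f \<in> sq_integrable \<mu>"
proof -
  have "compactin euclidean (f ` topspace X)"
    using image_compactin[OF _ f] compact by (simp add: compact_space_def)
  then have "bounded (f ` carrier G)"
    by (simp add: topspace_eq compact_imp_bounded)
  then obtain b where b: "\<And>x. x \<in> carrier G \<Longrightarrow> cmod (f x) \<le> b"
    by (auto simp: bounded_iff)
  have [measurable]: "f \<in> borel_measurable \<mu>" by (rule continuous_measurable[OF f])
  have "integrable \<mu> (\<lambda>x. (cmod (f x))\<^sup>2)"
    by (rule integrable_const_bound[where B = "b\<^sup>2"])
      (auto intro!: AE_I2 power_mono simp: space_haar b)
  then show ?thesis by (simp add: sq_integrable_def)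
qed

lemma right_translation_measurable:
  assumes s: "s \<in> carrier G"
  shows "(\<lambda>x. x \<otimes> s) \<in> \<mu> \<rightarrow>\<^sub>M \<mu>"
proof -
  have "(\<lambda>x. x \<otimes> s) \<in> \<mu> \<rightarrow>\<^sub>M sigma (topspace X) {U. openin X U}"
  proof (rule measurable_measure_of)
    show "{U. openin X U} \<subseteq> Pow (topspace X)" by (auto dest: openin_subset)
    show "(\<lambda>x. x \<otimes> s) \<in> space \<mu> \<rightarrow> topspace X"
      using s by (auto simp: space_haar topspace_eq)
    fix U assume "U \<in> {U. openin X U}"
    then have "openin X {x \<in> topspace X. x \<otimes> s \<in> U}"
      by (intro openin_continuous_map_preimage[OF right_translation_continuous[OF s]]) auto
    moreover have "{x \<in> topspace X. x \<otimes> s \<in> U} = (\<lambda>x. x \<otimes> s) -` U \<inter> space \<mu>"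
      by (auto simp: space_haar topspace_eq)
    ultimately show "(\<lambda>x. x \<otimes> s) -` U \<inter> space \<mu> \<in> sets \<mu>"
      by (metis open_in_sets_haar)
  qed
  then show ?thesis
    by (simp cong: measurable_cong_sets add: measurable_cong_sets[OF refl sets_haar])
qed

lemma distr_right_translation:
  assumes s: "s \<in> carrier G"
  shows "distr \<mu> \<mu> (\<lambda>x. x \<otimes> s) = \<mu>"
proof (rule measure_eqI)
  fix A assume "A \<in> sets (distr \<mu> \<mu> (\<lambda>x. x \<otimes> s))"
  then have A: "A \<in> sets \<mu>" by simp
  have sub: "A \<subseteq> carrier G" using sets.sets_into_space[OF A] by (simp add: space_haar)
  have "(\<lambda>x. x \<otimes> s) -` A \<inter> space \<mu> = A #> inv s"
  proof (rule subset_antisym; rule subsetI)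
    fix x assume "x \<in> (\<lambda>x. x \<otimes> s) -` A \<inter> space \<mu>"
    then have "x \<otimes> s \<in> A" "x = (x \<otimes> s) \<otimes> inv s"
      using s by (auto simp: space_haar m_assoc)
    then show "x \<in> A #> inv s" by (auto simp: r_coset_def)
  next
    fix x assume "x \<in> A #> inv s"
    then obtain a where "a \<in> A" "x = a \<otimes> inv s" by (auto simp: r_coset_def)
    moreover from this have "x \<otimes> s = a" using s sub by (auto simp: m_assoc)
    ultimately show "x \<in> (\<lambda>x. x \<otimes> s) -` A \<inter> space \<mu>"
      using s sub by (auto simp: space_haar)
  qed
  then show "emeasure (distr \<mu> \<mu> (\<lambda>x. x \<otimes> s)) A = emeasure \<mu> A"
    using emeasure_distr[OF right_translation_measurable[OF s] A]
      haar_right_invariant[OF _ A, of "inv s"] s by simp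
qed simp

lemma sq_integrable_right_translate:
  assumes s: "s \<in> carrier G" and f: "f \<in> sq_integrable \<mu>"
  shows "(\<lambda>x. f (x \<otimes> s)) \<in> sq_integrable \<mu>"
proof -
  note t = right_translation_measurable[OF s]
  have fm: "f \<in> borel_measurable \<mu>" and fi: "integrable \<mu> (\<lambda>x. (cmod (f x))\<^sup>2)"
    using f by (auto simp: sq_integrable_def)
  have "integrable (distr \<mu> \<mu> (\<lambda>x. x \<otimes> s)) (\<lambda>x. (cmod (f x))\<^sup>2)"
    using fi by (simp add: distr_right_translation[OF s])
  then have "integrable \<mu> (\<lambda>x. (cmod (f (x \<otimes> s)))\<^sup>2)"
    by (rule integrable_distr[OF t])
  then show ?thesis
    using measurable_compose[OF t fm] by (simp add: sq_integrable_def)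
qed

lemma AE_right_translate:
  assumes s: "s \<in> carrier G" and P: "AE x in \<mu>. P x"
  shows "AE x in \<mu>. P (x \<otimes> s)"
proof -
  have "AE x in distr \<mu> \<mu> (\<lambda>x. x \<otimes> s). P x"
    unfolding distr_right_translation[OF s] by (rule P)
  then show ?thesis by (rule AE_distrD[OF right_translation_measurable[OF s]])
qed

end

lemma sq_integrable_add:
  assumes "f \<in> sq_integrable \<mu>" "h \<in> sq_integrable \<mu>"
  shows "(\<lambda>x. f x + h x) \<in> sq_integrable \<mu>"
proof -
  have [measurable]: "f \<in> borel_measurable \<mu>" "h \<in> borel_measurable \<mu>"
    and i: "integrable \<mu> (\<lambda>x. (cmod (f x))\<^sup>2)" "integrable \<mu> (\<lambda>x. (cmod (h x))\<^sup>2)"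
    using assms by (auto simp: sq_integrable_def)
  have *: "(cmod (u + v))\<^sup>2 \<le> 2 * (cmod u)\<^sup>2 + 2 * (cmod v)\<^sup>2" for u v
  proof -
    have "(cmod (u + v))\<^sup>2 \<le> (cmod u + cmod v)\<^sup>2"
      by (intro power_mono norm_triangle_ineq) auto
    also have "\<dots> \<le> 2 * (cmod u)\<^sup>2 + 2 * (cmod v)\<^sup>2"
      using sum_squares_bound[of "cmod u" "cmod v"] by (simp add: power2_sum)
    finally show ?thesis .
  qed
  have "integrable \<mu> (\<lambda>x. 2 * (cmod (f x))\<^sup>2 + 2 * (cmod (h x))\<^sup>2)"
    using i by simp
  then have "integrable \<mu> (\<lambda>x. (cmod (f x + h x))\<^sup>2)"
    by (rule Bochner_Integration.integrable_bound) (auto simp: *)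
  then show ?thesis by (simp add: sq_integrable_def)
qed

lemma sq_integrable_cmult:
  assumes "f \<in> sq_integrable \<mu>"
  shows "(\<lambda>x. a * f x) \<in> sq_integrable \<mu>"
  using assms by (auto simp: sq_integrable_def norm_mult power_mult_distrib)

lemma sq_integrable_diff:
  assumes "f \<in> sq_integrable \<mu>" "h \<in> sq_integrable \<mu>"
  shows "(\<lambda>x. f x - h x) \<in> sq_integrable \<mu>"
  using sq_integrable_add[OF assms(1) sq_integrable_cmult[OF assms(2), of "-1"]] by simp

lemma sq_integrable_sum:
  assumes "\<And>i. i \<in> I \<Longrightarrow> f i \<in> sq_integrable \<mu>"
  shows "(\<lambda>x. \<Sum>i\<in>I. f i x) \<in> sq_integrable \<mu>"
  using assms
proof (induction I rule: infinite_finite_induct)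
  case (insert i I)
  then show ?case by (simp add: sq_integrable_add)
qed (simp_all add: sq_integrable_def)

lemma ae_rel_equiv: "equiv (sq_integrable \<mu>) (ae_rel \<mu>)"
proof (rule equivI)
  show "ae_rel \<mu> \<subseteq> sq_integrable \<mu> \<times> sq_integrable \<mu>" by (auto simp: ae_rel_def)
  show "refl_on (sq_integrable \<mu>) (ae_rel \<mu>)" by (auto simp: ae_rel_def refl_on_def)
  show "sym (ae_rel \<mu>)" by (auto simp: ae_rel_def sym_def elim: AE_mp)
  show "trans (ae_rel \<mu>)" by (auto simp: ae_rel_def trans_def)
qed

lemma L2_class_eqI: "(f, h) \<in> ae_rel \<mu> \<Longrightarrow> L2_class \<mu> f = L2_class \<mu> h"
  unfolding L2_class_def by (rule equiv_class_eq[OF ae_rel_equiv])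

lemma mem_L2_class: "h \<in> L2_class \<mu> f \<longleftrightarrow> (f, h) \<in> ae_rel \<mu>"
  by (simp add: L2_class_def)

lemma L2_class_self: "f \<in> sq_integrable \<mu> \<Longrightarrow> f \<in> L2_class \<mu> f"
  by (simp add: mem_L2_class ae_rel_def)

lemma L2_diff_L2_class:
  assumes "f \<in> sq_integrable \<mu>" "h \<in> sq_integrable \<mu>"
  shows "L2_diff \<mu> (L2_class \<mu> f) (L2_class \<mu> h) = L2_class \<mu> (\<lambda>x. f x - h x)"
proof -
  have "L2_class \<mu> (\<lambda>x. f' x - h' x) = L2_class \<mu> (\<lambda>x. f x - h x)"
    if "f' \<in> L2_class \<mu> f" "h' \<in> L2_class \<mu> h" for f' h'
    using that
    by (intro L2_class_eqI) (auto simp: mem_L2_class ae_rel_def sq_integrable_diff)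
  then show ?thesis
    unfolding L2_diff_def using L2_class_self assms by blast
qed

context haar_compact_group
begin

lemma right_average_sq_integrable:
  assumes "S \<subseteq> carrier G" "f \<in> sq_integrable \<mu>"
  shows "right_average G S f \<in> sq_integrable \<mu>"
  unfolding right_average_def
  by (intro sq_integrable_cmult sq_integrable_sum sq_integrable_right_translate) (use assms in auto)

lemma averaging_L2_class:
  assumes S: "S \<subseteq> carrier G" "finite S" and f: "f \<in> sq_integrable \<mu>"
  shows "averaging G \<mu> S (L2_class \<mu> f) = L2_class \<mu> (right_average G S f)"
proof -
  have "L2_class \<mu> (right_average G S h) = L2_class \<mu> (right_average G S f)"
    if h: "h \<in> L2_class \<mu> f" for h
  proof (rule L2_class_eqI)
    have h': "h \<in> sq_integrable \<mu>" and ae: "AE x in \<mu>. h x = f x"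
      using h by (auto simp: mem_L2_class ae_rel_def)
    have "AE x in \<mu>. \<forall>s\<in>S. h (x \<otimes> s) = f (x \<otimes> s)"
      using S by (intro AE_finite_allI AE_right_translate ae) auto
    then have "AE x in \<mu>. right_average G S h x = right_average G S f x"
      by eventually_elim (simp add: right_average_def)
    then show "(right_average G S h, right_average G S f) \<in> ae_rel \<mu>"
      using S f h' by (simp add: ae_rel_def right_average_sq_integrable)
  qed
  then show ?thesis
    unfolding averaging_def using L2_class_self[OF f] by blast
qed

lemma laplacian_L2_class:
  assumes "S \<subseteq> carrier G" "finite S" "f \<in> sq_integrable \<mu>"
  shows "laplacian G \<mu> S (L2_class \<mu> f) = L2_class \<mu> (\<lambda>x. f x - right_average G S f x)"
  using assms
  by (simp add: laplacian_def averaging_L2_class L2_diff_L2_class right_average_sq_integrable)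

end

definition unitary_rep ::
    "('a, 'b) monoid_scheme \<Rightarrow> 'a topology \<Rightarrow> nat \<Rightarrow> ('a \<Rightarrow> complex mat) \<Rightarrow> bool" where
  "unitary_rep G X d \<sigma> \<longleftrightarrow>
     (\<forall>g\<in>carrier G. \<sigma> g \<in> carrier_mat d d \<and>
        \<sigma> g * mat_adjoint (\<sigma> g) = 1\<^sub>m d \<and> mat_adjoint (\<sigma> g) * \<sigma> g = 1\<^sub>m d) \<and>
     (\<forall>g\<in>carrier G. \<forall>h\<in>carrier G. \<sigma> (g \<otimes>\<^bsub>G\<^esub> h) = \<sigma> g * \<sigma> h) \<and>
     (\<forall>i<d. \<forall>j<d. continuous_map X euclidean (\<lambda>g. \<sigma> g $$ (i, j)))"

definition irreducible_unitary_rep ::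
    "('a, 'b) monoid_scheme \<Rightarrow> 'a topology \<Rightarrow> nat \<Rightarrow> ('a \<Rightarrow> complex mat) \<Rightarrow> bool" where
  "irreducible_unitary_rep G X d \<sigma> \<longleftrightarrow>
     unitary_rep G X d \<sigma> \<and> d > 0 \<and>
     (\<forall>W. VectorSpace.subspace class_ring W (module_vec TYPE(complex) d) \<and>
          (\<forall>g\<in>carrier G. \<forall>v\<in>W. \<sigma> g *\<^sub>v v \<in> W) \<longrightarrow>
          W = {0\<^sub>v d} \<or> W = carrier_vec d)"

definition rep_dim :: "('a, 'b) monoid_scheme \<Rightarrow> ('a \<Rightarrow> complex mat) \<Rightarrow> nat" where
  "rep_dim G \<sigma> = dim_row (\<sigma> \<one>\<^bsub>G\<^esub>)"

definition irreps :: "('a, 'b) monoid_scheme \<Rightarrow> 'a topology \<Rightarrow> ('a \<Rightarrow> complex mat) set" where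
  "irreps G X = {\<sigma>. irreducible_unitary_rep G X (rep_dim G \<sigma>) \<sigma>}"

definition rep_equiv ::
    "('a, 'b) monoid_scheme \<Rightarrow> 'a topology \<Rightarrow> (('a \<Rightarrow> complex mat) \<times> ('a \<Rightarrow> complex mat)) set"
  where
  "rep_equiv G X = {(\<sigma>, \<tau>). \<sigma> \<in> irreps G X \<and> \<tau> \<in> irreps G X \<and> rep_dim G \<sigma> = rep_dim G \<tau> \<and>
     (\<exists>P\<in>carrier_mat (rep_dim G \<sigma>) (rep_dim G \<sigma>).
        invertible_mat P \<and> (\<forall>g\<in>carrier G. P * \<sigma> g = \<tau> g * P))}"

definition unitary_dual ::
    "('a, 'b) monoid_scheme \<Rightarrow> 'a topology \<Rightarrow> ('a \<Rightarrow> complex mat) set set" where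
  "unitary_dual G X = irreps G X // rep_equiv G X"

definition peter_weyl_block ::
    "('a, 'b) monoid_scheme \<Rightarrow> 'a measure \<Rightarrow> ('a \<Rightarrow> complex mat) \<Rightarrow> ('a \<Rightarrow> complex) set set" where
  "peter_weyl_block G \<mu> \<sigma> =
     {L2_class \<mu> (\<lambda>g. \<Sum>i<rep_dim G \<sigma>. \<Sum>j<rep_dim G \<sigma>. c i j * \<sigma> g $$ (i, j)) |
        c :: nat \<Rightarrow> nat \<Rightarrow> complex. True}"

lemma (in haar_compact_group) peter_weyl_block_subset_L2:
  assumes "\<sigma> \<in> irreps G X"
  shows "peter_weyl_block G \<mu> \<sigma> \<subseteq> L2 \<mu>"
proof -
  have "(\<lambda>g. \<sigma> g $$ (i, j)) \<in> sq_integrable \<mu>" if "i < rep_dim G \<sigma>" "j < rep_dim G \<sigma>" for i j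
    using that assms
    by (intro continuous_sq_integrable)
      (auto simp: irreps_def irreducible_unitary_rep_def unitary_rep_def)
  then have "(\<lambda>g. \<Sum>i<rep_dim G \<sigma>. \<Sum>j<rep_dim G \<sigma>. c i j * \<sigma> g $$ (i, j)) \<in> sq_integrable \<mu>" for c
    by (intro sq_integrable_sum sq_integrable_cmult) auto
  then show ?thesis
    by (auto simp: peter_weyl_block_def L2_def L2_class_def intro: quotientI)
qed

text \<open>
  \<open>T\<close> acts on the block of \<open>\<sigma>\<close> as \<open>I \<otimes> B\<close> under \<open>\<sigma>\<^sub>i\<^sub>j \<leftrightarrow> e\<^sub>i \<otimes> e\<^sub>j\<close>: it is the linear extension of
  \<open>\<sigma>\<^sub>i\<^sub>j \<mapsto> \<Sum>\<^sub>k \<sigma>\<^sub>i\<^sub>k B\<^sub>k\<^sub>j\<close>, so the value is prescribed on every linear combination with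
  coefficients \<open>c\<close>.
\<close>

definition acts_on_block_as_id_tensor ::
    "('a, 'b) monoid_scheme \<Rightarrow> 'a measure \<Rightarrow> ('a \<Rightarrow> complex mat) \<Rightarrow>
     (('a \<Rightarrow> complex) set \<Rightarrow> ('a \<Rightarrow> complex) set) \<Rightarrow> complex mat \<Rightarrow> bool" where
  "acts_on_block_as_id_tensor G \<mu> \<sigma> T B \<longleftrightarrow>
     (\<forall>c :: nat \<Rightarrow> nat \<Rightarrow> complex.
        T (L2_class \<mu> (\<lambda>g. \<Sum>i<rep_dim G \<sigma>. \<Sum>j<rep_dim G \<sigma>. c i j * \<sigma> g $$ (i, j))) =
        L2_class \<mu> (\<lambda>g. \<Sum>i<rep_dim G \<sigma>. \<Sum>j<rep_dim G \<sigma>.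
                          c i j * (\<Sum>k<rep_dim G \<sigma>. \<sigma> g $$ (i, k) * B $$ (k, j))))"

definition rep_mean ::
    "('a, 'b) monoid_scheme \<Rightarrow> 'a set \<Rightarrow> ('a \<Rightarrow> complex mat) \<Rightarrow> complex mat" where
  "rep_mean G S \<sigma> = mat (rep_dim G \<sigma>) (rep_dim G \<sigma>)
     (\<lambda>(i, j). (1 / of_nat (card S)) * (\<Sum>s\<in>S. \<sigma> s $$ (i, j)))"

definition mat_trace :: "complex mat \<Rightarrow> complex" where
  "mat_trace A = (\<Sum>i<dim_row A. A $$ (i, i))"

text \<open>
  \<open>omega\<close> is a function of the equivalence class: the common value of the defining expression
  at all representatives.
\<close>

definition omega ::
    "('a, 'b) monoid_scheme \<Rightarrow> 'a set \<Rightarrow> ('a \<Rightarrow> complex mat) set \<Rightarrow> complex" where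
  "omega G S C =
     (THE w. \<forall>\<sigma>\<in>C. w = 1 - mat_trace (rep_mean G S \<sigma>) / of_nat (rep_dim G \<sigma>))"

end

theory Submission
  imports Defs
begin

text \<open>
  Everything follows from \<open>\<sigma> (g s) = \<sigma> g \<sigma> s\<close>: averaging over \<open>s\<close> multiplies \<open>\<sigma>\<close> by \<open>M\<^sub>\<sigma>\<close> on the
  right, which gives the action on the block.  Since \<open>\<sigma> (inv s)\<close> is the adjoint of \<open>\<sigma> s\<close> and \<open>S\<close>
  is symmetric, the trace of \<open>M\<^sub>\<sigma>\<close> is real, and since the entries of a unitary matrix have modulus
  at most \<open>1\<close>, it lies between \<open>-d\<^sub>\<sigma>\<close> and \<open>d\<^sub>\<sigma>\<close>.  Traces are invariant under similarity, so the
  value depends on the class of \<open>\<sigma>\<close> only.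
\<close>

section \<open>Adjoints, traces and unitary matrices\<close>

lemma mat_adjoint_carrier: "A \<in> carrier_mat n m \<Longrightarrow> mat_adjoint A \<in> carrier_mat m n"
  by (auto simp: mat_adjoint_def)

lemma mat_adjoint_index:
  assumes "A \<in> carrier_mat n m" "i < m" "j < n"
  shows "mat_adjoint A $$ (i, j) = cnj (A $$ (j, i))"
  using assms by (auto simp: mat_adjoint_def mat_of_rows_def)

lemma mat_mult_index_sum:
  assumes "A \<in> carrier_mat n m" "B \<in> carrier_mat m k" "i < n" "j < k"
  shows "(A * B) $$ (i, j) = (\<Sum>l<m. A $$ (i, l) * B $$ (l, j))"
  using assms by (auto simp: scalar_prod_def lessThan_atLeast0 intro!: sum.cong)

lemma mat_trace_mult_comm:
  assumes "A \<in> carrier_mat n m" "B \<in> carrier_mat m n"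
  shows "mat_trace (A * B) = mat_trace (B * A)"
proof -
  have "mat_trace (A * B) = (\<Sum>i<n. \<Sum>l<m. A $$ (i, l) * B $$ (l, i))"
    \<comment> \<open>\<open>index_mult_mat(1)\<close> is removed because it would turn the entries
      into scalar products before the explicit sums apply.\<close>
    using assms mat_mult_index_sum[OF assms]
    by (simp add: mat_trace_def del: index_mult_mat(1))
  also have "\<dots> = (\<Sum>l<m. \<Sum>i<n. B $$ (l, i) * A $$ (i, l))"
    by (subst sum.swap) (simp add: mult.commute)
  also have "\<dots> = mat_trace (B * A)"
    using assms mat_mult_index_sum[OF assms(2,1)]
    by (simp add: mat_trace_def del: index_mult_mat(1))
  finally show ?thesis .
qed

text \<open>With Q inverse to \<open>P\<close>, \<open>A\<close> = Q \<open>B\<close>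
  \<open>P\<close>, and cyclicity of the trace moves \<open>P\<close> next to Q. This is what makes
  the trace a class function of representations.\<close>

lemma mat_trace_intertwined:
  assumes P: "P \<in> carrier_mat n n" "invertible_mat P"
    and A: "A \<in> carrier_mat n n" and B: "B \<in> carrier_mat n n"
    and eq: "P * A = B * P"
  shows "mat_trace A = mat_trace B"
proof -
  obtain Q where PQ: "P * Q = 1\<^sub>m n" and QP: "Q * P = 1\<^sub>m (dim_row Q)"
    using P by (auto simp: invertible_mat_def inverts_mat_def)
  \<comment> \<open>The two inverse equations do not give the size of \<open>Q\<close> directly;
    comparing column counts on both sides recovers it.\<close>
  have "dim_col Q = n" using arg_cong[OF PQ, of dim_col] by simp
  moreover have "dim_row Q = n" using arg_cong[OF QP, of dim_col] P by simp
  ultimately have Q: "Q \<in> carrier_mat n n" by auto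
  have "mat_trace A = mat_trace ((Q * P) * A)"
    using QP Q A by simp
  also have "\<dots> = mat_trace (Q * (B * P))"
    using Q P A by (simp add: assoc_mult_mat[of _ n n _ n _ n] eq)
  also have "\<dots> = mat_trace ((B * P) * Q)"
    using Q P B by (intro mat_trace_mult_comm) auto
  also have "\<dots> = mat_trace B"
    using Q P B PQ by (simp add: assoc_mult_mat[of _ n n _ n _ n])
  finally show ?thesis .
qed

text \<open>The diagonal entries of \<open>A * mat_adjoint A\<close> are the squared norms of the
  rows of \<open>A\<close>, so each row is a unit vector and no entry exceeds its norm.\<close>

lemma cmod_entry_unitary_le_1:
  assumes A: "A \<in> carrier_mat n n" and u: "A * mat_adjoint A = 1\<^sub>m n"
    and i: "i < n" and j: "j < n"
  shows "cmod (A $$ (i, j)) \<le> 1"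
proof -
  have "(A * mat_adjoint A) $$ (i, i) = (\<Sum>l<n. A $$ (i, l) * cnj (A $$ (i, l)))"
    using A i by (subst mat_mult_index_sum[OF A mat_adjoint_carrier[OF A]])
      (auto simp: mat_adjoint_index[OF A])
  also have "\<dots> = of_real (\<Sum>l<n. (cmod (A $$ (i, l)))\<^sup>2)"
    by (simp flip: complex_norm_square)
  finally have "(\<Sum>l<n. (cmod (A $$ (i, l)))\<^sup>2) = 1"
    using u i by (metis index_one_mat(1) of_real_eq_1_iff)
  moreover have "(cmod (A $$ (i, j)))\<^sup>2 \<le> (\<Sum>l<n. (cmod (A $$ (i, l)))\<^sup>2)"
    using j by (intro member_le_sum) auto
  ultimately show ?thesis by (simp add: power_le_one_iff)
qed

section \<open>The trace of the averaged matrix\<close>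

lemma rep_mean_carrier: "rep_mean G S \<sigma> \<in> carrier_mat (rep_dim G \<sigma>) (rep_dim G \<sigma>)"
  by (simp add: rep_mean_def)

lemma mat_trace_rep_mean:
  assumes "\<And>s. s \<in> S \<Longrightarrow> \<sigma> s \<in> carrier_mat (rep_dim G \<sigma>) (rep_dim G \<sigma>)"
  shows "mat_trace (rep_mean G S \<sigma>) = (\<Sum>s\<in>S. mat_trace (\<sigma> s)) / of_nat (card S)"
proof -
  have "mat_trace (rep_mean G S \<sigma>)
      = (\<Sum>i<rep_dim G \<sigma>. \<Sum>s\<in>S. \<sigma> s $$ (i, i)) / of_nat (card S)"
    by (simp add: mat_trace_def rep_mean_def sum_divide_distrib)
  also have "(\<Sum>i<rep_dim G \<sigma>. \<Sum>s\<in>S. \<sigma> s $$ (i, i))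
      = (\<Sum>s\<in>S. \<Sum>i<rep_dim G \<sigma>. \<sigma> s $$ (i, i))"
    by (rule sum.swap)
  also have "\<dots> = (\<Sum>s\<in>S. mat_trace (\<sigma> s))"
    by (rule sum.cong) (simp_all add: mat_trace_def carrier_matD(1)[OF assms])
  finally show ?thesis .
qed

section \<open>Unitary representations and their traces\<close>

context group
begin

text \<open>Multiplicativity makes the image of \<open>\<one>\<close> idempotent, and an idempotent
  unitary matrix is the identity.\<close>

lemma unitary_rep_one:
  assumes "unitary_rep G X d \<sigma>"
  shows "\<sigma> \<one> = 1\<^sub>m d"
proof -
  have c: "\<sigma> \<one> \<in> carrier_mat d d" and u: "\<sigma> \<one> * mat_adjoint (\<sigma> \<one>) = 1\<^sub>m d"
    and m: "\<sigma> \<one> * \<sigma> \<one> = \<sigma> \<one>"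
    using assms unfolding unitary_rep_def by (auto, metis one_closed r_one)
  have "\<sigma> \<one> = \<sigma> \<one> * (\<sigma> \<one> * mat_adjoint (\<sigma> \<one>))"
    using c by (simp add: u)
  also have "\<dots> = 1\<^sub>m d"
    using c by (subst assoc_mult_mat[symmetric, of _ d d _ d _ d])
      (auto simp: m u mat_adjoint_carrier)
  finally show ?thesis .
qed

text \<open>\<open>\<sigma> (inv s)\<close> is a left inverse of \<open>\<sigma> s\<close> and the
  adjoint is a right inverse, so they coincide.\<close>

lemma unitary_rep_inv:
  assumes r: "unitary_rep G X d \<sigma>" and s: "s \<in> carrier G"
  shows "\<sigma> (inv s) = mat_adjoint (\<sigma> s)"
proof -
  have c: "\<sigma> s \<in> carrier_mat d d" "\<sigma> (inv s) \<in> carrier_mat d d"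
    and u: "\<sigma> s * mat_adjoint (\<sigma> s) = 1\<^sub>m d"
    using r s by (auto simp: unitary_rep_def)
  have m: "\<sigma> (inv s) * \<sigma> s = \<sigma> \<one>"
    using r s unfolding unitary_rep_def by (metis inv_closed l_inv)
  have "\<sigma> (inv s) = \<sigma> (inv s) * (\<sigma> s * mat_adjoint (\<sigma> s))"
    using c by (simp add: u)
  also have "\<dots> = (\<sigma> (inv s) * \<sigma> s) * mat_adjoint (\<sigma> s)"
    using c by (subst assoc_mult_mat[of _ d d _ d _ d]) (auto simp: mat_adjoint_carrier)
  also have "\<dots> = mat_adjoint (\<sigma> s)"
    using c s mat_adjoint_carrier[OF c(1)] by (simp add: m unitary_rep_one[OF r])
  finally show ?thesis .
qed

lemma cnj_mat_trace_unitary_rep: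
  assumes r: "unitary_rep G X d \<sigma>" and s: "s \<in> carrier G"
  shows "cnj (mat_trace (\<sigma> s)) = mat_trace (\<sigma> (inv s))"
proof -
  have c: "\<sigma> s \<in> carrier_mat d d"
    using r s by (auto simp: unitary_rep_def)
  show ?thesis
    using c mat_adjoint_carrier[OF c]
    by (auto simp: mat_trace_def unitary_rep_inv[OF r s] mat_adjoint_index[OF c])
qed

lemma cmod_mat_trace_unitary_rep:
  assumes r: "unitary_rep G X d \<sigma>" and s: "s \<in> carrier G"
  shows "cmod (mat_trace (\<sigma> s)) \<le> d"
proof -
  have c: "\<sigma> s \<in> carrier_mat d d" and u: "\<sigma> s * mat_adjoint (\<sigma> s) = 1\<^sub>m d"
    using r s by (auto simp: unitary_rep_def)
  have "cmod (mat_trace (\<sigma> s)) \<le> (\<Sum>i<d. 1)"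
    unfolding mat_trace_def carrier_matD(1)[OF c]
    by (intro sum_norm_le cmod_entry_unitary_le_1[OF c u]) auto
  then show ?thesis by simp
qed

lemma irreps_unitary_rep:
  assumes "\<sigma> \<in> irreps G X"
  shows "unitary_rep G X (rep_dim G \<sigma>) \<sigma>"
  using assms by (simp add: irreps_def irreducible_unitary_rep_def)

lemma irreps_rep_dim_pos: "\<sigma> \<in> irreps G X \<Longrightarrow> 0 < rep_dim G \<sigma>"
  by (simp add: irreps_def irreducible_unitary_rep_def)

lemma irreps_carrier_mat:
  assumes "\<sigma> \<in> irreps G X" "g \<in> carrier G"
  shows "\<sigma> g \<in> carrier_mat (rep_dim G \<sigma>) (rep_dim G \<sigma>)"
  using irreps_unitary_rep[OF assms(1)] assms(2) by (simp add: unitary_rep_def)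

section \<open>Independence of the representative, and the range of \<open>omega\<close>\<close>

lemma rep_equiv_refl:
  assumes "\<sigma> \<in> irreps G X"
  shows "(\<sigma>, \<sigma>) \<in> rep_equiv G X"
proof -
  have "invertible_mat (1\<^sub>m n :: complex mat)" for n
    by (auto simp: invertible_mat_def inverts_mat_def intro!: exI[of _ "1\<^sub>m n"])
  moreover have "1\<^sub>m (rep_dim G \<sigma>) * \<sigma> g = \<sigma> g * 1\<^sub>m (rep_dim G \<sigma>)" if "g \<in> carrier G" for g
    using irreps_carrier_mat[OF assms that] by simp
  ultimately show ?thesis
    using assms by (auto simp: rep_equiv_def intro!: bexI[of _ "1\<^sub>m (rep_dim G \<sigma>)"])
qed

text \<open>A single intertwiner \<open>P\<close> serves every \<open>s\<close> in \<open>S\<close>,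
  so the traces agree summand by summand.\<close>

lemma mat_trace_rep_mean_equiv:
  assumes e: "(\<sigma>, \<tau>) \<in> rep_equiv G X" and S: "S \<subseteq> carrier G"
  shows "mat_trace (rep_mean G S \<sigma>) = mat_trace (rep_mean G S \<tau>)"
proof -
  obtain P where P: "P \<in> carrier_mat (rep_dim G \<sigma>) (rep_dim G \<sigma>)" "invertible_mat P"
    and eq: "\<And>g. g \<in> carrier G \<Longrightarrow> P * \<sigma> g = \<tau> g * P"
    and i: "\<sigma> \<in> irreps G X" "\<tau> \<in> irreps G X" and d: "rep_dim G \<tau> = rep_dim G \<sigma>"
    using e unfolding rep_equiv_def by fastforce
  have "mat_trace (\<sigma> s) = mat_trace (\<tau> s)" if "s \<in> S" for s
  proof -
    have s: "s \<in> carrier G" using that S by auto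
    show ?thesis
      using irreps_carrier_mat[OF i(1) s] irreps_carrier_mat[OF i(2) s] eq[OF s]
      unfolding d by (rule mat_trace_intertwined[OF P])
  qed
  moreover have "mat_trace (rep_mean G S \<rho>) = (\<Sum>s\<in>S. mat_trace (\<rho> s)) / of_nat (card S)"
    if "\<rho> \<in> irreps G X" for \<rho>
    using S by (intro mat_trace_rep_mean irreps_carrier_mat[OF that]) auto
  ultimately show ?thesis
    using i by simp
qed

text \<open>All members of \<open>C\<close> give the same value, so the description in
  \<open>omega\<close> is satisfiable; the member \<open>\<sigma>\<close> pins the value down, so it
  is unique.\<close>

lemma omega_eq:
  assumes C: "C \<in> unitary_dual G X" and \<sigma>: "\<sigma> \<in> C" and S: "S \<subseteq> carrier G"
  shows "omega G S C = 1 - mat_trace (rep_mean G S \<sigma>) / of_nat (rep_dim G \<sigma>)"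
proof -
  obtain \<rho> where "C = rep_equiv G X `` {\<rho>}"
    using C unfolding unitary_dual_def by (rule quotientE)
  then have e: "(\<rho>, \<tau>) \<in> rep_equiv G X" if "\<tau> \<in> C" for \<tau>
    using that by simp
  have "rep_dim G \<tau> = rep_dim G \<rho>" if "\<tau> \<in> C" for \<tau>
    using e[OF that] unfolding rep_equiv_def by force
  moreover have "mat_trace (rep_mean G S \<tau>) = mat_trace (rep_mean G S \<rho>)" if "\<tau> \<in> C" for \<tau>
    using mat_trace_rep_mean_equiv[OF e[OF that] S] by simp
  ultimately have eq: "1 - mat_trace (rep_mean G S \<tau>) / of_nat (rep_dim G \<tau>)
      = 1 - mat_trace (rep_mean G S \<sigma>) / of_nat (rep_dim G \<sigma>)" if "\<tau> \<in> C" for \<tau>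
    using that \<sigma> by presburger
  show ?thesis
    unfolding omega_def
  proof (rule the_equality)
    show "\<forall>\<tau>\<in>C. 1 - mat_trace (rep_mean G S \<sigma>) / of_nat (rep_dim G \<sigma>)
        = 1 - mat_trace (rep_mean G S \<tau>) / of_nat (rep_dim G \<tau>)"
      using eq by metis
  qed (use \<sigma> in blast)
qed

lemma trace_rep_mean_bound:
  assumes i: "\<sigma> \<in> irreps G X" and S: "S \<subseteq> carrier G" "finite S"
    and sym: "\<And>s. s \<in> S \<Longrightarrow> inv s \<in> S"
  shows "1 - mat_trace (rep_mean G S \<sigma>) / of_nat (rep_dim G \<sigma>) \<in> complex_of_real ` {0..2}"
proof -
  define t where "t = mat_trace (rep_mean G S \<sigma>) / of_nat (rep_dim G \<sigma>)"
  note r = irreps_unitary_rep[OF i]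
  have tr: "mat_trace (rep_mean G S \<sigma>) = (\<Sum>s\<in>S. mat_trace (\<sigma> s)) / of_nat (card S)"
    using S by (intro mat_trace_rep_mean irreps_carrier_mat[OF i]) auto
  have "cnj (\<Sum>s\<in>S. mat_trace (\<sigma> s)) = (\<Sum>s\<in>S. mat_trace (\<sigma> (inv s)))"
    using S by (auto simp: cnj_mat_trace_unitary_rep[OF r] intro!: sum.cong)
  also have "\<dots> = (\<Sum>s\<in>S. mat_trace (\<sigma> s))"
    \<comment> \<open>Inversion is an involution of the symmetric set \<open>S\<close>, hence its
      own reindexing witness.\<close>
    using S sym by (intro sum.reindex_bij_witness[of _ "\<lambda>s. inv s" "\<lambda>s. inv s"]) auto
  finally have "cnj t = t"
    by (simp add: t_def tr)
  then obtain x where x: "t = of_real x"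
    using Reals_cnj_iff Reals_cases by metis
  have "cmod (\<Sum>s\<in>S. mat_trace (\<sigma> s)) \<le> (\<Sum>s\<in>S. real (rep_dim G \<sigma>))"
    using S by (intro sum_norm_le cmod_mat_trace_unitary_rep[OF r]) auto
  moreover have "cmod t = cmod (\<Sum>s\<in>S. mat_trace (\<sigma> s)) / (card S * rep_dim G \<sigma>)"
    by (simp add: t_def tr norm_divide norm_mult)
  \<comment> \<open>The numerator is at most the denominator; \<open>divide_le_eq_1\<close> also
    covers a zero denominator, where the quotient is 0.\<close>
  ultimately have "cmod t \<le> 1"
    by (auto simp: divide_le_eq_1 zero_less_mult_iff)
  then have "1 - x \<in> {0..2}" "1 - t = of_real (1 - x)"
    by (auto simp: x abs_le_iff)
  then show ?thesis
    unfolding t_def[symmetric] by blast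
qed

end

section \<open>The Laplacian on a Peter-Weyl block\<close>

context haar_compact_group
begin

lemma irreps_entry_sq_integrable:
  assumes "\<sigma> \<in> irreps G X" "i < rep_dim G \<sigma>" "j < rep_dim G \<sigma>"
  shows "(\<lambda>g. \<sigma> g $$ (i, j)) \<in> sq_integrable \<mu>"
  using irreps_unitary_rep[OF assms(1)] assms(2,3)
  by (intro continuous_sq_integrable) (simp add: unitary_rep_def)

lemma right_average_entry:
  assumes i: "\<sigma> \<in> irreps G X" and S: "S \<subseteq> carrier G" and g: "g \<in> carrier G"
    and ij: "i < rep_dim G \<sigma>" "j < rep_dim G \<sigma>"
  shows "right_average G S (\<lambda>g. \<sigma> g $$ (i, j)) g
      = (\<Sum>k<rep_dim G \<sigma>. \<sigma> g $$ (i, k) * rep_mean G S \<sigma> $$ (k, j))"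
proof -
  have "\<sigma> (g \<otimes> s) $$ (i, j) = (\<Sum>k<rep_dim G \<sigma>. \<sigma> g $$ (i, k) * \<sigma> s $$ (k, j))"
    if "s \<in> S" for s
  proof -
    have s: "s \<in> carrier G" using that S by auto
    then have "\<sigma> (g \<otimes> s) = \<sigma> g * \<sigma> s"
      using irreps_unitary_rep[OF i] g by (simp add: unitary_rep_def)
    then show ?thesis
      using mat_mult_index_sum[OF irreps_carrier_mat[OF i g] irreps_carrier_mat[OF i s] ij] by simp
  qed
  then have "(\<Sum>s\<in>S. \<sigma> (g \<otimes> s) $$ (i, j))
      = (\<Sum>k<rep_dim G \<sigma>. \<sigma> g $$ (i, k) * (\<Sum>s\<in>S. \<sigma> s $$ (k, j)))"
    by (simp add: sum_distrib_left sum.swap[of _ S])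
  then show ?thesis
    using ij by (simp add: right_average_def rep_mean_def flip: sum_divide_distrib)
qed

text \<open>Both sides are classes of explicit functions, so a pointwise identity on
  \<open>carrier G\<close>, the whole space of \<open>\<mu>\<close>, suffices. It follows from
  linearity of averaging and \<open>right_average_entry\<close>.\<close>

lemma laplacian_acts_on_block:
  assumes i: "\<sigma> \<in> irreps G X" and S: "S \<subseteq> carrier G" "finite S"
  shows "acts_on_block_as_id_tensor G \<mu> \<sigma> (laplacian G \<mu> S)
    (1\<^sub>m (rep_dim G \<sigma>) - rep_mean G S \<sigma>)"
  unfolding acts_on_block_as_id_tensor_def
proof
  fix c :: "nat \<Rightarrow> nat \<Rightarrow> complex"
  let ?d = "rep_dim G \<sigma>" and ?M = "rep_mean G S \<sigma>"
  let ?B = "1\<^sub>m ?d - ?M"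
  let ?f = "\<lambda>g. \<Sum>i<?d. \<Sum>j<?d. c i j * \<sigma> g $$ (i, j)"
  let ?h = "\<lambda>g. \<Sum>i<?d. \<Sum>j<?d. c i j * (\<Sum>k<?d. \<sigma> g $$ (i, k) * ?B $$ (k, j))"
  have f: "?f \<in> sq_integrable \<mu>"
    by (intro sq_integrable_sum sq_integrable_cmult irreps_entry_sq_integrable[OF i]) auto
  have h: "?h \<in> sq_integrable \<mu>"
    \<comment> \<open>This puts the constant on the left of each entry, the shape
      \<open>sq_integrable_cmult\<close> expects.\<close>
    unfolding mult.commute[of "\<sigma> _ $$ _"]
    by (intro sq_integrable_sum sq_integrable_cmult irreps_entry_sq_integrable[OF i]) auto
  have eq: "?f g - right_average G S ?f g = ?h g" if g: "g \<in> carrier G" for g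
  proof -
    have avg: "right_average G S ?f g
        = (\<Sum>i<?d. \<Sum>j<?d. c i j * right_average G S (\<lambda>g. \<sigma> g $$ (i, j)) g)"
      unfolding right_average_def
      by (simp add: sum_distrib_left sum.swap[of _ S] mult.left_commute sum_divide_distrib)
    have entry: "(\<Sum>k<?d. \<sigma> g $$ (i, k) * ?B $$ (k, j))
        = \<sigma> g $$ (i, j) - (\<Sum>k<?d. \<sigma> g $$ (i, k) * ?M $$ (k, j))"
      if "j < ?d" for i j
    proof -
      \<comment> \<open>The identity matrix contributes a Kronecker delta, which selects the term
        \<open>k = j\<close>.\<close>
      have "(\<Sum>k<?d. \<sigma> g $$ (i, k) * ?B $$ (k, j))
          = (\<Sum>k<?d. (if k = j then \<sigma> g $$ (i, k) else 0) - \<sigma> g $$ (i, k) * ?M $$ (k, j))"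
        using that rep_mean_carrier[of G S \<sigma>] by (intro sum.cong) (auto simp: algebra_simps)
      then show ?thesis using that by (simp add: sum_subtractf)
    qed
    show ?thesis
      unfolding avg
      by (simp add: right_average_entry[OF i S(1) g] entry right_diff_distrib sum_subtractf)
  qed
  have "L2_class \<mu> (\<lambda>g. ?f g - right_average G S ?f g) = L2_class \<mu> ?h"
    using f h eq S
    by (intro L2_class_eqI)
      (auto simp: ae_rel_def space_haar intro!: AE_I2 sq_integrable_diff right_average_sq_integrable)
  then show "laplacian G \<mu> S (L2_class \<mu> ?f) = L2_class \<mu> ?h"
    using laplacian_L2_class[OF S f] by simp
qed

end

text \<open>Regrouping by the entries of \<open>\<sigma>\<close> exhibits the image as another
  combination of them: the coefficient matrix \<open>c\<close> is replaced by \<open>c\<close> times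
  the transpose of \<open>B\<close>.\<close>

lemma acts_on_block_preserves:
  assumes "acts_on_block_as_id_tensor G \<mu> \<sigma> T B"
  shows "T ` peter_weyl_block G \<mu> \<sigma> \<subseteq> peter_weyl_block G \<mu> \<sigma>"
proof
  let ?d = "rep_dim G \<sigma>"
  fix q assume "q \<in> T ` peter_weyl_block G \<mu> \<sigma>"
  then obtain c :: "nat \<Rightarrow> nat \<Rightarrow> complex" where q: "q = L2_class \<mu> (\<lambda>g. \<Sum>i<?d. \<Sum>j<?d.
      c i j * (\<Sum>k<?d. \<sigma> g $$ (i, k) * B $$ (k, j)))"
    using assms by (auto simp: acts_on_block_as_id_tensor_def peter_weyl_block_def)
  have "(\<Sum>j<?d. c i j * (\<Sum>k<?d. \<sigma> g $$ (i, k) * B $$ (k, j)))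
      = (\<Sum>k<?d. (\<Sum>j<?d. c i j * B $$ (k, j)) * \<sigma> g $$ (i, k))" for g i
    unfolding sum_distrib_left sum_distrib_right by (subst sum.swap) (simp add: mult_ac)
  then show "q \<in> peter_weyl_block G \<mu> \<sigma>"
    unfolding q peter_weyl_block_def
    by (auto intro!: exI[of _ "\<lambda>i k. \<Sum>j<?d. c i j * B $$ (k, j)"])
qed

theorem proposition11:
  fixes G :: "('a, 'b) monoid_scheme" (structure)
    and X :: "'a topology" and \<mu> :: "'a measure" and S :: "'a set"
  assumes "compact_hausdorff_group G X"
    and "normalized_haar_measure G X \<mu>"
    and "S \<subseteq> carrier G" and "finite S" and "S \<noteq> {}"
    and "\<forall>s\<in>S. inv s \<in> S" and "\<one> \<notin> S"
  shows "\<forall>C\<in>unitary_dual G X.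
    (\<forall>\<sigma>\<in>C.
       laplacian G \<mu> S ` peter_weyl_block G \<mu> \<sigma> \<subseteq> peter_weyl_block G \<mu> \<sigma> \<and>
       acts_on_block_as_id_tensor G \<mu> \<sigma> (laplacian G \<mu> S)
         (1\<^sub>m (rep_dim G \<sigma>) - rep_mean G S \<sigma>)) \<and>
    (\<forall>\<sigma>\<in>C. rep_dim G \<sigma> \<noteq> 0 \<and>
       omega G S C = 1 - mat_trace (rep_mean G S \<sigma>) / of_nat (rep_dim G \<sigma>)) \<and>
    omega G S C \<in> complex_of_real ` {0..2}"
proof -
  interpret haar_compact_group G X \<mu>
    using assms(1,2) by (simp add: haar_compact_group_def haar_compact_group_axioms_def)
  show ?thesis
  proof
    fix C assume C: "C \<in> unitary_dual G X"
    then obtain \<rho> where \<rho>: "\<rho> \<in> irreps G X" "C = rep_equiv G X `` {\<rho>}"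
      by (auto simp: unitary_dual_def quotient_def)
    then have irr: "\<sigma> \<in> irreps G X" if "\<sigma> \<in> C" for \<sigma>
      using that by (auto simp: rep_equiv_def)
    \<comment> \<open>The range of \<open>omega\<close> on \<open>C\<close> can be read off at any
      one representative; reflexivity supplies \<open>\<rho>\<close>.\<close>
    have "\<rho> \<in> C"
      using \<rho> rep_equiv_refl by auto
    then have "omega G S C \<in> complex_of_real ` {0..2}"
      using omega_eq[OF C _ assms(3)] trace_rep_mean_bound[OF \<rho>(1) assms(3,4)] assms(6) by simp
    moreover have "acts_on_block_as_id_tensor G \<mu> \<sigma> (laplacian G \<mu> S)
        (1\<^sub>m (rep_dim G \<sigma>) - rep_mean G S \<sigma>)" if "\<sigma> \<in> C" for \<sigma>
      using laplacian_acts_on_block[OF irr[OF that] assms(3,4)] .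
    moreover have "rep_dim G \<sigma> \<noteq> 0 \<and>
        omega G S C = 1 - mat_trace (rep_mean G S \<sigma>) / of_nat (rep_dim G \<sigma>)" if "\<sigma> \<in> C" for \<sigma>
      using omega_eq[OF C that assms(3)] irreps_rep_dim_pos[OF irr[OF that]] by simp
    ultimately show "(\<forall>\<sigma>\<in>C.
       laplacian G \<mu> S ` peter_weyl_block G \<mu> \<sigma> \<subseteq> peter_weyl_block G \<mu> \<sigma> \<and>
       acts_on_block_as_id_tensor G \<mu> \<sigma> (laplacian G \<mu> S)
         (1\<^sub>m (rep_dim G \<sigma>) - rep_mean G S \<sigma>)) \<and>
    (\<forall>\<sigma>\<in>C. rep_dim G \<sigma> \<noteq> 0 \<and>
       omega G S C = 1 - mat_trace (rep_mean G S \<sigma>) / of_nat (rep_dim G \<sigma>)) \<and>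
    omega G S C \<in> complex_of_real ` {0..2}"
      using acts_on_block_preserves by blast
  qed
qed

end
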